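(* Let $k\ge1$ be an integer. There exist constants $\alpha_k,\gamma_k>0$ depending only on $k$ such that the following holds. Let $\lambda\in(0,1)$, let $I$ be a subarc of $\mathbb T$ of length $2\pi\lambda$, let $f\in H^{k,2}$ with $\|f\|_{k,2}\le1$, let $S_n=\{x_1,\dots,x_n\}$ be a set of $n$ distinct points of $I$, and let $f_n$ be the element of minimal $\|\cdot\|_{k,2}$-norm among all $g\in H^{k,2}$ with $g(x_i)=f(x_i)$ for $i=1,\dots,n$. Set $h_n=\sup_{x\in I}d(x,S_n)$. If $h_n\le e^{-\gamma_k/\lambda}$, then $$\|f-f_n\|_2\leq\frac{\alpha_k}{(\lambda\log(1/h_n))^k}.$$
   Context: $\mathbb D$ is the open unit disk, $\mathbb T$ the unit circle. $H^2$ is the Hardy space of $\mathbb D$ with $\|f\|_2=\left(\frac{1}{2\pi}\int_0^{2\pi}|f(e^{i\theta})|^2d\theta\right)^{1/2}$ on boundary values; $H^{k,2}=\{f\in H^2: f^{(j)}\in H^2,\ j=1,\dots,k\}$ with Hilbert norm $\|f\|_{k,2}^2=\sum_{j=0}^k\|f^{(j)}\|_2^2$ (derivatives in $z$). Functions in $H^{k,2}$, $k\ge1$, extend continuously to $\overline{\mathbb D}$, so point values on $\mathbb T$ make sense, and the minimal-norm interpolant $f_n$ exists and is unique (it is the orthogonal projection of $f$ onto the orthogonal complement of the closed subspace of functions vanishing on $S_n$). $d(x,S_n)$ denotes the radial (angular) distance on $\mathbb T$ from $x$ to the set $S_n$. *)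

theory Defs
  imports "HOL-Analysis.Analysis"
begin

definition circ_mean2 :: "(complex \<Rightarrow> complex) \<Rightarrow> real \<Rightarrow> real" where
  "circ_mean2 f r = (1 / (2 * pi)) * integral {0..2*pi} (\<lambda>t. (cmod (f (of_real r * cis t)))\<^sup>2)"

definition H2 :: "(complex \<Rightarrow> complex) \<Rightarrow> bool" where
  "H2 f \<longleftrightarrow> f holomorphic_on ball 0 1 \<and> bdd_above (circ_mean2 f ` {0..<1})"

text \<open>The H^2 norm (equal to the L^2 norm of the boundary values).\<close>
definition H2_norm :: "(complex \<Rightarrow> complex) \<Rightarrow> real" where
  "H2_norm f = sqrt (SUP r\<in>{0..<1}. circ_mean2 f r)"

definition Hk2 :: "nat \<Rightarrow> (complex \<Rightarrow> complex) \<Rightarrow> bool" where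
  "Hk2 k f \<longleftrightarrow> H2 f \<and> (\<forall>j\<in>{1..k}. H2 ((deriv ^^ j) f))"

definition Hk2_norm :: "nat \<Rightarrow> (complex \<Rightarrow> complex) \<Rightarrow> real" where
  "Hk2_norm k f = sqrt (\<Sum>j\<le>k. (H2_norm ((deriv ^^ j) f))\<^sup>2)"

text \<open>Boundary value at a point x of the unit circle (radial limit, which equals the
  value of the continuous extension for functions in H^{k,2}, k >= 1).\<close>
definition bval :: "(complex \<Rightarrow> complex) \<Rightarrow> complex \<Rightarrow> complex" where
  "bval f x = Lim (at_left 1) (\<lambda>r::real. f (of_real r * x))"

definition angdist :: "complex \<Rightarrow> complex \<Rightarrow> real" where
  "angdist x y = \<bar>Arg (x * cnj y)\<bar>"

definition arc :: "real \<Rightarrow> real \<Rightarrow> complex set" where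
  "arc a lam = (\<lambda>t. cis t) ` {a .. a + 2*pi*lam}"

definition min_interp :: "nat \<Rightarrow> (complex \<Rightarrow> complex) \<Rightarrow> complex set \<Rightarrow> (complex \<Rightarrow> complex) \<Rightarrow> bool" where
  "min_interp k f S g \<longleftrightarrow> Hk2 k g \<and> (\<forall>x\<in>S. bval g x = bval f x) \<and>
     (\<forall>h. Hk2 k h \<and> (\<forall>x\<in>S. bval h x = bval f x) \<longrightarrow> Hk2_norm k g \<le> Hk2_norm k h)"

definition fill_dist :: "complex set \<Rightarrow> complex set \<Rightarrow> real" where
  "fill_dist I S = (SUP x\<in>I. Min (angdist x ` S))"

end

theory Submission
  imports Defs "HOL-Complex_Analysis.Complex_Analysis"
begin

text \<open>Let \<open>g = f - fn\<close>, which has norm at most 2 and vanishes on \<open>S\<close>. Since \<open>g'\<close> is in the Hardy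
  space, \<open>g\<close> is Hoelder continuous on the closed disk, so it is of size \<open>h powr (1/4)\<close> on the arc,
  where \<open>h\<close> is the fill distance. A two-constants estimate (maximum modulus for \<open>g\<close> times the
  exponential of an explicit rational function) turns this into \<open>\<bar>g\<bar> \<le> M exp (- c L)\<close> on the disk
  of radius 1/3, with \<open>L = \<lambda> ln (1/h)\<close>. By Parseval, the Taylor coefficients of \<open>g\<close> of order below a
  small multiple of \<open>L\<close> are then exponentially small in \<open>L\<close>, while those of order \<open>\<ge> N\<close> contribute
  at most a constant times \<open>N\<close> to the power \<open>-k\<close> to the norm, because the \<open>k\<close>-th derivative is
  bounded.\<close>

section \<open>Hardy norms and Taylor coefficients\<close>

lemma has_integral_cis_orthogonal:
  fixes m n :: nat
  assumes "m \<noteq> n"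
  shows "((\<lambda>t. cis t ^ m * cnj (cis t ^ n)) has_integral 0) {0..2*pi}"
proof -
  define d :: real where "d = real m - real n"
  have d: "d \<noteq> 0" using assms by (simp add: d_def)
  have eq: "cis t ^ m * cnj (cis t ^ n) = cis (d * t)" for t
    by (simp only: Complex.DeMoivre complex_cnj_power cis_cnj cis_mult d_def left_diff_distrib
        mult_minus_right add_uminus_conv_diff)
  have der: "((\<lambda>t. cis (d * t) / (\<i> * d)) has_vector_derivative cis (d * t)) (at t within {0..2*pi})" for t
  proof -
    have "((\<lambda>z. exp (\<i> * d * z) / (\<i> * d)) has_field_derivative exp (\<i> * d * of_real t)) (at (of_real t))"
      using d by (auto intro!: derivative_eq_intros)
    then have "((\<lambda>t. exp (\<i> * d * of_real t) / (\<i> * d)) has_vector_derivative exp (\<i> * d * of_real t)) (at t within {0..2*pi})"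
      by (rule has_vector_derivative_real_field)
    then show ?thesis by (simp add: cis_conv_exp mult.assoc)
  qed
  have "((\<lambda>t. cis (d * t)) has_integral (cis (d * (2*pi)) / (\<i> * d) - cis (d * 0) / (\<i> * d))) {0..2*pi}"
    by (rule fundamental_theorem_of_calculus) (auto intro: der)
  moreover have "cis (d * (2*pi)) = 1"
  proof -
    have "cis (d * (2*pi)) = cis (2*pi) ^ m * cnj (cis (2*pi) ^ n)"
      using eq[of "2*pi"] by simp
    then show ?thesis by simp
  qed
  ultimately show ?thesis unfolding eq by simp
qed

text \<open>Induction on \<open>N\<close>: when the square is expanded, the new term adds its own
  squared modulus and a cross term that integrates to 0 by orthogonality.\<close>

lemma has_integral_norm2_trig_poly:
  fixes c :: "nat \<Rightarrow> complex"
  shows "((\<lambda>t. (cmod (\<Sum>n<N. c n * cis t ^ n))\<^sup>2) has_integral 2*pi*(\<Sum>n<N. (cmod (c n))\<^sup>2)) {0..2*pi}"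
proof (induction N)
  case 0
  then show ?case by simp
next
  case (Suc N)
  let ?p = "\<lambda>t. \<Sum>n<N. c n * cis t ^ n"
  have "((\<lambda>t. \<Sum>n<N. c n * cnj (c N) * (cis t ^ n * cnj (cis t ^ N))) has_integral (\<Sum>n<N. c n * cnj (c N) * 0)) {0..2*pi}"
    by (intro has_integral_sum has_integral_mult_right has_integral_cis_orthogonal) auto
  then have "((\<lambda>t. ?p t * cnj (c N * cis t ^ N)) has_integral 0) {0..2*pi}"
    by (simp add: sum_distrib_left sum_distrib_right mult_ac)
  then have cross: "((\<lambda>t. 2 * Re (?p t * cnj (c N * cis t ^ N))) has_integral 2 * Re 0) {0..2*pi}"
    by (intro has_integral_mult_right has_integral_Re)
  have const: "((\<lambda>t. (cmod (c N))\<^sup>2) has_integral 2*pi*(cmod (c N))\<^sup>2) {0..2*pi}"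
    using has_integral_const_real[of "(cmod (c N))\<^sup>2" 0 "2*pi"] by simp
  have "(cmod (\<Sum>n<Suc N. c n * cis t ^ n))\<^sup>2
      = (cmod (?p t))\<^sup>2 + 2 * Re (?p t * cnj (c N * cis t ^ N)) + (cmod (c N))\<^sup>2" for t
  proof -
    have "(cmod (x + y))\<^sup>2 = (cmod x)\<^sup>2 + 2 * Re (x * cnj y) + (cmod y)\<^sup>2" for x y
      by (simp add: cmod_power2) algebra
    from this[of "?p t" "c N * cis t ^ N"] show ?thesis
      by (simp only: sum.lessThan_Suc norm_mult norm_power norm_cis power_one mult_1_right)
  qed
  moreover have "2*pi*(\<Sum>n<Suc N. (cmod (c n))\<^sup>2)
      = 2*pi*(\<Sum>n<N. (cmod (c n))\<^sup>2) + 2 * Re 0 + 2*pi*(cmod (c N))\<^sup>2"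
    by (simp add: algebra_simps)
  ultimately show ?case
    using has_integral_add[OF has_integral_add[OF Suc cross] const] by (simp only:)
qed

text \<open>Passage from polynomials to series by dominated convergence; absolute summability
  supplies a constant majorant.\<close>

lemma Parseval_absolutely_convergent:
  fixes c :: "nat \<Rightarrow> complex"
  assumes c: "summable (\<lambda>n. cmod (c n))"
  shows "(\<lambda>n. (cmod (c n))\<^sup>2) sums
    ((1 / (2*pi)) * integral {0..2*pi} (\<lambda>t. (cmod (\<Sum>n. c n * cis t ^ n))\<^sup>2))"
proof -
  let ?p = "\<lambda>N t. (cmod (\<Sum>n<N. c n * cis t ^ n))\<^sup>2"
  have "(\<lambda>N. integral {0..2*pi} (?p N)) \<longlonglongrightarrow> integral {0..2*pi} (\<lambda>t. (cmod (\<Sum>n. c n * cis t ^ n))\<^sup>2)"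
  proof (rule dominated_convergence(2)[where h = "\<lambda>_. (\<Sum>n. cmod (c n))\<^sup>2"])
    show "?p N integrable_on {0..2*pi}" for N
      using has_integral_norm2_trig_poly by blast
    show "norm (?p N t) \<le> (\<Sum>n. cmod (c n))\<^sup>2" for N t
    proof -
      have "cmod (\<Sum>n<N. c n * cis t ^ n) \<le> (\<Sum>n<N. cmod (c n))"
        by (rule sum_norm_le) (simp add: norm_mult norm_power)
      also have "\<dots> \<le> (\<Sum>n. cmod (c n))"
        by (rule sum_le_suminf[OF c]) auto
      finally show ?thesis by (simp add: power_mono)
    qed
    show "(\<lambda>N. ?p N t) \<longlonglongrightarrow> (cmod (\<Sum>n. c n * cis t ^ n))\<^sup>2" for t
      by (intro tendsto_intros summable_LIMSEQ summable_norm_cancel[where f = "\<lambda>n. c n * cis t ^ n"])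
        (simp add: norm_mult norm_power c)
  qed auto
  then have "(\<lambda>N. 2*pi*(\<Sum>n<N. (cmod (c n))\<^sup>2)) \<longlonglongrightarrow> integral {0..2*pi} (\<lambda>t. (cmod (\<Sum>n. c n * cis t ^ n))\<^sup>2)"
    by (simp add: integral_unique[OF has_integral_norm2_trig_poly])
  from tendsto_mult_left[OF this, of "1/(2*pi)"] show ?thesis
    by (simp add: sums_def)
qed

section \<open>Taylor coefficients versus Hardy norms\<close>

definition coef :: "(complex \<Rightarrow> complex) \<Rightarrow> nat \<Rightarrow> complex" where
  "coef f n = (deriv ^^ n) f 0 / fact n"

lemma coef_sums:
  assumes "f holomorphic_on ball 0 1" "cmod z < 1"
  shows "(\<lambda>n. coef f n * z ^ n) sums f z"
  using holomorphic_power_series[OF assms(1), of z] assms(2) by (simp add: coef_def)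

lemma circ_mean2_sums:
  assumes f: "f holomorphic_on ball 0 1" and r: "0 \<le> r" "r < 1"
  shows "(\<lambda>n. (cmod (coef f n * r ^ n))\<^sup>2) sums circ_mean2 f r"
proof -
  have "summable (\<lambda>n. cmod (coef f n * complex_of_real r ^ n))"
  proof (rule powser_insidea)
    \<comment> \<open>The series converges at the larger radius \<open>(1+r)/2 < 1\<close>, hence
      absolutely at \<open>r\<close>.\<close>
    show "summable (\<lambda>n. coef f n * complex_of_real ((1+r)/2) ^ n)"
      by (rule sums_summable[OF coef_sums[OF f]]) (use r in \<open>simp only: norm_of_real\<close>, simp)
    show "norm (complex_of_real r) < norm (complex_of_real ((1+r)/2))"
      unfolding norm_of_real using r by simp
  qed
  from Parseval_absolutely_convergent[OF this]
  have "(\<lambda>n. (cmod (coef f n * r ^ n))\<^sup>2) sums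
      ((1 / (2*pi)) * integral {0..2*pi} (\<lambda>t. (cmod (\<Sum>n. coef f n * r ^ n * cis t ^ n))\<^sup>2))"
    by (simp only: of_real_power)
  moreover have "(\<Sum>n. coef f n * r ^ n * cis t ^ n) = f (r * cis t)" for t
    using coef_sums[OF f, of "r * cis t"] r
    by (simp add: sums_iff power_mult_distrib norm_mult mult.assoc)
  ultimately show ?thesis by (simp add: circ_mean2_def)
qed

lemma circ_mean2_nonneg: "circ_mean2 f r \<ge> 0"
proof (cases "(\<lambda>t. (cmod (f (of_real r * cis t)))\<^sup>2) integrable_on {0..2*pi}")
  case True
  then show ?thesis
    unfolding circ_mean2_def by (intro mult_nonneg_nonneg Henstock_Kurzweil_Integration.integral_nonneg) auto
next
  \<comment> \<open>The integral of a non-integrable function is 0 by convention.\<close>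
  case False
  then show ?thesis by (simp add: circ_mean2_def not_integrable_integral)
qed

lemma H2_holomorphic: "H2 f \<Longrightarrow> f holomorphic_on ball 0 1"
  by (simp add: H2_def)

lemma circ_mean2_le_H2_norm:
  assumes "H2 f" "0 \<le> r" "r < 1"
  shows "circ_mean2 f r \<le> (H2_norm f)\<^sup>2"
proof -
  have "circ_mean2 f r \<le> (SUP r\<in>{0..<1}. circ_mean2 f r)"
    using assms by (intro cSUP_upper) (auto simp: H2_def)
  then show ?thesis
    using circ_mean2_nonneg[of f r] by (simp add: H2_norm_def)
qed

text \<open>Parseval at radius \<open>r\<close>, cut to finitely many terms so that \<open>r\<close>
  can tend to 1. Together with \<open>H2_norm_le\<close> it replaces the supremum of means by the l2
  norm of the coefficients.\<close>

lemma sum_coef2_le_H2_norm: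
  assumes "H2 f"
  shows "(\<Sum>n<N. (cmod (coef f n))\<^sup>2) \<le> (H2_norm f)\<^sup>2"
proof (rule tendsto_upperbound)
  show "((\<lambda>r::real. \<Sum>n<N. (cmod (coef f n) * r ^ n)\<^sup>2) \<longlongrightarrow> (\<Sum>n<N. (cmod (coef f n))\<^sup>2)) (at_left 1)"
    by (auto intro!: tendsto_eq_intros)
  have "(\<Sum>n<N. (cmod (coef f n) * r ^ n)\<^sup>2) \<le> (H2_norm f)\<^sup>2" if "r \<in> {0<..<1}" for r
  proof -
    have "(\<Sum>n<N. (cmod (coef f n * r ^ n))\<^sup>2) \<le> circ_mean2 f r"
    proof -
      have s: "(\<lambda>n. (cmod (coef f n * complex_of_real r ^ n))\<^sup>2) sums circ_mean2 f r"
        using circ_mean2_sums[OF H2_holomorphic[OF assms], of r] that by simp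
      show ?thesis
        using sum_le_suminf[OF sums_summable[OF s], of "{..<N}"] sums_unique[OF s] by simp
    qed
    also have "\<dots> \<le> (H2_norm f)\<^sup>2"
      using circ_mean2_le_H2_norm[OF assms] that by auto
    finally show ?thesis using that by (simp add: norm_mult norm_power)
  qed
  then show "\<forall>\<^sub>F r in at_left 1. (\<Sum>n<N. (cmod (coef f n) * r ^ n)\<^sup>2) \<le> (H2_norm f)\<^sup>2"
    using eventually_at_left_real[of 0 1] by (auto elim: eventually_mono)
qed simp

text \<open>The converse direction: the factor \<open>r ^ n\<close> only shrinks each term, so a
  bound on the undamped partial sums bounds every circular mean.\<close>

lemma H2_norm_le:
  assumes f: "f holomorphic_on ball 0 1" and "B \<ge> 0"
    and le: "\<And>N. (\<Sum>n<N. (cmod (coef f n))\<^sup>2) \<le> B\<^sup>2"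
  shows "H2_norm f \<le> B"
proof -
  have "circ_mean2 f r \<le> B\<^sup>2" if r: "r \<in> {0..<1}" for r
  proof -
    have s: "(\<lambda>n. (cmod (coef f n * r ^ n))\<^sup>2) sums circ_mean2 f r"
      using circ_mean2_sums[OF f] r by auto
    have "(\<Sum>n<N. (cmod (coef f n * r ^ n))\<^sup>2) \<le> B\<^sup>2" for N
    proof -
      have "(\<Sum>n<N. (cmod (coef f n * r ^ n))\<^sup>2) \<le> (\<Sum>n<N. (cmod (coef f n))\<^sup>2)"
        using r by (intro sum_mono power_mono) (auto simp: norm_mult norm_power intro!: mult_left_le power_le_one)
      then show ?thesis using le[of N] by linarith
    qed
    then show ?thesis
      unfolding sums_unique[OF s] by (intro suminf_le_const[OF sums_summable[OF s]]) simp
  qed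
  then have "(SUP r\<in>{0..<1}. circ_mean2 f r) \<le> B\<^sup>2"
    by (intro cSUP_least) auto
  then show ?thesis
    unfolding H2_norm_def using \<open>B \<ge> 0\<close> by (metis real_le_lsqrt)
qed

lemma coef_higher_deriv:
  "coef ((deriv ^^ j) f) n = (fact (n + j) / fact n) * coef f (n + j)"
  by (simp add: coef_def funpow_add)

lemma coef_diff:
  assumes "f holomorphic_on ball 0 1" "g holomorphic_on ball 0 1"
  shows "coef (\<lambda>z. f z - g z) n = coef f n - coef g n"
  using higher_deriv_diff[OF assms, of 0 n] by (simp add: coef_def diff_divide_distrib)

lemma Hk2_higher_deriv: "Hk2 k f \<Longrightarrow> j \<le> k \<Longrightarrow> H2 ((deriv ^^ j) f)"
  by (cases "j = 0") (auto simp: Hk2_def)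

lemma H2_norm_higher_deriv_le:
  assumes "Hk2 k f" "j \<le> k"
  shows "(H2_norm ((deriv ^^ j) f))\<^sup>2 \<le> (Hk2_norm k f)\<^sup>2"
proof -
  have "(H2_norm ((deriv ^^ j) f))\<^sup>2 \<le> (\<Sum>j\<le>k. (H2_norm ((deriv ^^ j) f))\<^sup>2)"
    by (rule member_le_sum) (use assms in auto)
  then show ?thesis by (simp add: Hk2_norm_def sum_nonneg)
qed

text \<open>The form in which the norm enters: \<open>j = 0\<close> bounds the value at 0,
  \<open>j = 1\<close> gives Hoelder continuity, \<open>j = k\<close> controls the coefficients of
  high order.\<close>

lemma sum_coef2_deriv_le:
  assumes "Hk2 k f" "Hk2_norm k f \<le> 1" "j \<le> k"
  shows "(\<Sum>n<N. (fact (n + j) / fact n * cmod (coef f (n + j)))\<^sup>2) \<le> 1"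
proof -
  have "0 \<le> Hk2_norm k f"
    by (simp add: Hk2_norm_def sum_nonneg)
  then have "(Hk2_norm k f)\<^sup>2 \<le> 1"
    using assms by (simp add: power_le_one)
  then show ?thesis
    using sum_coef2_le_H2_norm[OF Hk2_higher_deriv[OF assms(1,3)], of N] H2_norm_higher_deriv_le[OF assms(1,3)]
    by (simp add: coef_higher_deriv norm_mult norm_divide)
qed

section \<open>A two-constants estimate for an arc\<close>

text \<open>Put \<open>q = arc_weight s z\<close> and let \<open>x = tan (\<theta>/2) / s\<close> for \<open>z = cis \<theta>\<close>. Then \<open>q = 1 / (1 - \<i> x)\<close>
  and the real part of \<open>q + 3 q\<^sup>2\<close> is \<open>(4 - 2 x\<^sup>2) / (1 + x\<^sup>2)\<^sup>2\<close>: it is at most 4 everywhere, nonpositive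
  for \<open>x\<^sup>2 \<ge> 2\<close>, hence off the arc \<open>\<bar>\<theta>\<bar> \<le> \<pi> s\<close>, and still its value at the centre is of order \<open>s\<close>.
  It replaces the harmonic measure of the arc.\<close>
definition arc_weight :: "real \<Rightarrow> complex \<Rightarrow> complex" where
  "arc_weight s z = s * (1 + z) / ((1 - z) + s * (1 + z))"

text \<open>A zero would satisfy \<open>(1 - s) * z = 1 + s\<close> and so lie outside the closed
  disk.\<close>

lemma arc_weight_denom_nonzero:
  assumes "0 < s" "s < 1" "cmod z \<le> 1"
  shows "(1 - z) + of_real s * (1 + z) \<noteq> 0"
proof
  assume "(1 - z) + of_real s * (1 + z) = 0"
  then have "of_real (1 + s) = of_real (1 - s) * z"
    by (simp add: algebra_simps)
  then have "1 + s = (1 - s) * cmod z"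
    using assms by (metis abs_of_pos add_pos_pos diff_gt_0_iff_gt norm_mult norm_of_real zero_less_one)
  also have "\<dots> \<le> (1 - s) * 1"
    using assms by (intro mult_left_mono) auto
  finally show False using assms by simp
qed

text \<open>With \<open>x\<close> the rescaled half-angle tangent, \<open>x\<^sup>2 = Q / P\<close>.
  The cleared form stays valid at \<open>z = -1\<close>, where \<open>P = 0\<close>.\<close>

lemma Re_arc_weight_circle:
  assumes s: "0 < s" "s < 1" and z: "cmod z = 1"
  defines "P \<equiv> s\<^sup>2 * (1 + Re z)" and "Q \<equiv> 1 - Re z"
  shows "Re (arc_weight s z + 3 * (arc_weight s z)\<^sup>2) = P * (4 * P - 2 * Q) / (P + Q)\<^sup>2" "P + Q > 0"
proof -
  define x y where "x = Re z" and "y = Im z"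
  have zxy: "z = Complex x y" by (simp add: x_def y_def)
  have xy: "x\<^sup>2 + y\<^sup>2 = 1" using z by (simp add: x_def y_def cmod_def)
  have x: "-1 \<le> x" "x \<le> 1"
    using abs_Re_le_cmod[of z] z by (auto simp: x_def)
  show PQ: "P + Q > 0"
  proof (cases "x = 1")
    case True
    then show ?thesis using s by (simp add: P_def Q_def flip: x_def)
  next
    case False
    then have "Q > 0" "P \<ge> 0" using x by (auto simp: P_def Q_def simp flip: x_def)
    then show ?thesis by linarith
  qed
  define D where "D = (1 - z) + of_real s * (1 + z)"
  have D0: "D \<noteq> 0" using arc_weight_denom_nonzero[of s z] s z by (simp add: D_def)
  \<comment> \<open>On the circle \<open>(1 - z) * cnj (1 + z)\<close> is purely imaginary, so no
    cross term survives.\<close>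
  have DD: "D * cnj D = of_real (2 * (P + Q))"
    using xy unfolding D_def zxy P_def Q_def
    by (simp add: complex_eq_iff) algebra
  have nD: "of_real s * (1 + z) * cnj D = Complex (2 * P) (2 * s * y)"
    using xy unfolding D_def zxy P_def Q_def
    by (simp add: complex_eq_iff) algebra
  have "arc_weight s z = of_real s * (1 + z) * cnj D / (D * cnj D)"
    using D0 by (simp add: arc_weight_def D_def[symmetric])
  also have "\<dots> = Complex (P / (P + Q)) (s * y / (P + Q))"
    unfolding DD nD using PQ
    by (simp add: complex_eq_iff Re_divide_of_real Im_divide_of_real mult.assoc del: distrib_left_numeral of_real_mult of_real_add)
  finally have q: "arc_weight s z = Complex (P / (P + Q)) (s * y / (P + Q))" .
  have sy: "(s * y)\<^sup>2 = P * Q"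
    using xy by (simp add: P_def Q_def flip: x_def) algebra
  have "Re (arc_weight s z + 3 * (arc_weight s z)\<^sup>2)
      = P / (P + Q) + 3 * ((P / (P + Q))\<^sup>2 - (s * y / (P + Q))\<^sup>2)"
    by (simp add: q power2_eq_square)
  also have "\<dots> = (P * (P + Q) + 3 * (P\<^sup>2 - P * Q)) / (P + Q)\<^sup>2"
  proof -
    have "P / (P + Q) = P * (P + Q) / (P + Q)\<^sup>2"
      using PQ by (simp add: power2_eq_square)
    then show ?thesis
      unfolding power_divide sy
      by (simp only: add_divide_distrib diff_divide_distrib right_diff_distrib times_divide_eq_right)
  qed
  also have "\<dots> = P * (4 * P - 2 * Q) / (P + Q)\<^sup>2"
    by (rule arg_cong[where f = "\<lambda>w. w / (P + Q)\<^sup>2"]) algebra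
  finally show "Re (arc_weight s z + 3 * (arc_weight s z)\<^sup>2) = P * (4 * P - 2 * Q) / (P + Q)\<^sup>2" .
qed

lemma Re_arc_weight_le:
  assumes s: "0 < s" "s < 1" and z: "cmod z = 1"
  shows "Re (arc_weight s z + 3 * (arc_weight s z)\<^sup>2) \<le> 4"
proof -
  define P where "P = s\<^sup>2 * (1 + Re z)"
  define Q where "Q = 1 - Re z"
  have "P \<ge> 0" "Q \<ge> 0"
    using abs_Re_le_cmod[of z] z by (auto simp: P_def Q_def)
  then have "P * (4 * P - 2 * Q) \<le> 4 * (P + Q)\<^sup>2"
    by (simp add: power2_eq_square algebra_simps)
  then show ?thesis
    using Re_arc_weight_circle[OF assms] by (simp add: P_def Q_def divide_le_eq)
qed

text \<open>This is \<open>x\<^sup>2 \<ge> 2\<close> without division. Monotonicity of the cosine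
  reduces it to the endpoint \<open>pi * s\<close>; there it follows from
  \<open>tan x \<ge> x\<close> at \<open>x = pi * s / 2\<close> and
  \<open>pi\<^sup>2 \<ge> 8\<close>.\<close>

lemma cos_far_from_arc:
  fixes s \<theta> :: real
  assumes s: "0 < s" "s < 1" and \<theta>: "pi * s \<le> \<bar>\<theta>\<bar>" "\<bar>\<theta>\<bar> \<le> pi"
  shows "2 * s\<^sup>2 * (1 + cos \<theta>) \<le> 1 - cos \<theta>"
proof -
  define x where "x = pi * s / 2"
  have x: "0 < x" "x < pi / 2"
    using s by (auto simp: x_def)
  have cx: "cos x > 0" using x by (intro cos_gt_zero_pi) auto
  have "x \<le> tan x" using abs_tan_ge[of x] x tan_gt_zero[of x] by auto
  then have "x * cos x \<le> sin x" using cx by (simp add: tan_def field_simps)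
  then have 1: "(x * cos x)\<^sup>2 \<le> (sin x)\<^sup>2"
    using x cx by (intro power_mono) auto
  have "(3::real)\<^sup>2 \<le> pi\<^sup>2"
    using pi_gt3 by (intro power_mono) auto
  then have "2 * s\<^sup>2 \<le> x\<^sup>2"
    by (auto simp: x_def power_mult_distrib power_divide intro!: mult_right_mono)
  then have "2 * s\<^sup>2 * (cos x)\<^sup>2 \<le> x\<^sup>2 * (cos x)\<^sup>2"
    by (intro mult_right_mono) auto
  with 1 have 2: "2 * s\<^sup>2 * (cos x)\<^sup>2 \<le> (sin x)\<^sup>2"
    by (simp add: power_mult_distrib)
  have "cos \<bar>\<theta>\<bar> \<le> cos (2 * x)"
    using x \<theta> by (subst cos_mono_le_eq) (auto simp: x_def)
  then have 3: "cos \<theta> \<le> cos (2 * x)" by simp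
  have "2 * s\<^sup>2 * (1 + cos \<theta>) \<le> 2 * s\<^sup>2 * (1 + cos (2 * x))"
    using 3 by (intro mult_left_mono) auto
  also have "\<dots> = 2 * (2 * s\<^sup>2 * (cos x)\<^sup>2)"
    by (simp add: cos_double_cos)
  also have "\<dots> \<le> 2 * (sin x)\<^sup>2" using 2 by simp
  also have "\<dots> = 1 - cos (2 * x)" by (simp add: cos_double_sin)
  also have "\<dots> \<le> 1 - cos \<theta>" using 3 by simp
  finally show ?thesis .
qed

lemma cis_Arg_unit: "cmod z = 1 \<Longrightarrow> cis (Arg z) = z"
  using cis_Arg[of z] by (cases "z = 0") (auto simp: sgn_div_norm)

lemma Re_arc_weight_off_arc:
  assumes s: "0 < s" "s < 1" and z: "cmod z = 1" and arg: "pi * s \<le> \<bar>Arg z\<bar>"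
  shows "Re (arc_weight s z + 3 * (arc_weight s z)\<^sup>2) \<le> 0"
proof -
  have "Re z = cos (Arg z)" using cis_Arg_unit[OF z] by (metis cis.sel(1))
  then have "2 * (s\<^sup>2 * (1 + Re z)) \<le> 1 - Re z"
    using cos_far_from_arc[OF s arg] Arg_bounded[of z] by (auto simp: abs_le_iff)
  moreover have "s\<^sup>2 * (1 + Re z) \<ge> 0"
    using abs_Re_le_cmod[of z] z by auto
  ultimately show ?thesis
    unfolding Re_arc_weight_circle(1)[OF s z]
    by (intro divide_nonpos_nonneg mult_nonneg_nonpos) auto
qed

text \<open>The bound comes from \<open>q = arc_weight s z\<close> alone, whose real part is
  \<open>s * R / d\<close> with \<open>R \<ge> 8/9\<close> and \<open>d \<le> 4\<close>; the term in
  \<open>q\<^sup>2\<close> only has to be nonnegative.\<close>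

lemma Re_arc_weight_ge:
  assumes s: "0 < s" "s < 1" and z: "cmod z \<le> 1/3"
  shows "2 * s / 9 \<le> Re (arc_weight s z + 3 * (arc_weight s z)\<^sup>2)"
proof -
  define x y where "x = Re z" and "y = Im z"
  have zxy: "z = Complex x y" by (simp add: x_def y_def)
  have xy: "x\<^sup>2 + y\<^sup>2 \<le> 1/9"
    using power_mono[OF z norm_ge_zero, of 2] by (simp add: x_def y_def cmod_power2 power_divide)
  have y: "\<bar>y\<bar> \<le> 1/3" using abs_Im_le_cmod[of z] z by (simp add: y_def)
  define D where "D = (1 - z) + of_real s * (1 + z)"
  have D0: "D \<noteq> 0" using arc_weight_denom_nonzero[of s z] s z by (simp add: D_def)
  define d where "d = (cmod D)\<^sup>2"
  have d: "d > 0" using D0 by (simp add: d_def)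
  have "D = of_real (1 + s) - of_real (1 - s) * z" by (simp add: D_def algebra_simps)
  then have "cmod D \<le> (1 + s) + (1 - s) * cmod z"
    using norm_triangle_ineq4[of "of_real (1 + s)" "of_real (1 - s) * z"] s
    by (simp add: norm_mult del: of_real_add of_real_diff)
  also have "\<dots> \<le> (1 + s) + (1 - s) * (1/3)"
    using s z by (intro add_left_mono mult_left_mono) auto
  also have "\<dots> = 4/3 + 2/3 * s" by algebra
  also have "\<dots> \<le> 2" using s by simp
  finally have "d \<le> 2\<^sup>2" unfolding d_def by (intro power_mono) auto
  then have d4: "d \<le> 4" by simp
  define R where "R = (1 - x\<^sup>2 - y\<^sup>2) + s * ((1 + x)\<^sup>2 + y\<^sup>2)"
  have "0 \<le> s * ((1 + x)\<^sup>2 + y\<^sup>2)" using s by simp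
  then have R: "R \<ge> 8/9" using xy by (simp add: R_def)
  have nD: "of_real s * (1 + z) * cnj D = Complex (s * R) (s * (2 * y))"
    unfolding D_def zxy R_def by (simp add: complex_eq_iff) algebra
  have "arc_weight s z = of_real s * (1 + z) * cnj D / of_real d"
    unfolding arc_weight_def D_def[symmetric] d_def by (subst complex_div_cnj) simp
  then have q: "arc_weight s z = Complex (s * R / d) (s * (2 * y) / d)"
    unfolding nD by (simp add: complex_eq_iff)
  \<comment> \<open>Thus the imaginary part of \<open>q\<close> is at most its real part in modulus,
    and \<open>q\<^sup>2\<close> has nonnegative real part.\<close>
  have "\<bar>2 * y\<bar> \<le> R" using y R by linarith
  then have "(2 * y)\<^sup>2 \<le> R\<^sup>2" by (rule abs_le_square_iff[THEN iffD1, OF order_trans]) simp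
  then have "(s / d)\<^sup>2 * (2 * y)\<^sup>2 \<le> (s / d)\<^sup>2 * R\<^sup>2" by (rule mult_left_mono) simp
  then have "0 \<le> Re ((arc_weight s z)\<^sup>2)"
    by (simp add: q power2_eq_square mult_ac)
  moreover have "2 * s / 9 \<le> s * R / d"
  proof -
    have "2 / 9 \<le> R / d" using R d d4 by (simp add: le_divide_eq)
    from mult_left_mono[OF this, of s] s show ?thesis by simp
  qed
  ultimately show ?thesis by (simp add: q)
qed

text \<open>The maximum principle bounds \<open>G * exp (L * u)\<close> by \<open>M\<close>;
  dividing by the exponential at \<open>z\<close> leaves the gain. The exponent is
  \<open>s / 18 = (2 * s / 9) / 4\<close>.\<close>

lemma two_constants_arc:
  fixes G :: "complex \<Rightarrow> complex"
  assumes cont: "continuous_on (cball 0 1) G" and hol: "G holomorphic_on ball 0 1"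
    and s: "0 < s" "s < 1" and \<epsilon>: "0 < \<epsilon>" "\<epsilon> \<le> 1"
    and M: "\<And>z. cmod z = 1 \<Longrightarrow> cmod (G z) \<le> M"
    and small: "\<And>z. cmod z = 1 \<Longrightarrow> \<bar>Arg z\<bar> \<le> pi * s \<Longrightarrow> cmod (G z) \<le> M * \<epsilon>"
    and z: "cmod z \<le> 1/3"
  shows "cmod (G z) \<le> M * \<epsilon> powr (s / 18)"
proof -
  \<comment> \<open>The 4 is the upper bound of the real part of \<open>u\<close> on the circle: on
    the arc the exponential is at most \<open>1 / \<epsilon>\<close>, exactly what the smallness of
    \<open>G\<close> there absorbs.\<close>
  define L where "L = ln (1 / \<epsilon>) / 4"
  have L: "L \<ge> 0" using \<epsilon> by (simp add: L_def)
  have M0: "M \<ge> 0" using M[of 1] norm_ge_zero[of "G 1"] by (simp del: norm_ge_zero)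
  define u where "u = (\<lambda>z. arc_weight s z + 3 * (arc_weight s z)\<^sup>2)"
  define F where "F = (\<lambda>z. G z * exp (of_real L * u z))"
  have nz: "(1 - w) + of_real s * (1 + w) \<noteq> 0" if "cmod w \<le> 1" for w
    using arc_weight_denom_nonzero s that by blast
  have "cmod (F z) \<le> M"
  proof (rule maximum_modulus_frontier[where f = F and S = "cball 0 1"])
    show "F holomorphic_on interior (cball 0 1)"
      unfolding F_def u_def arc_weight_def
      using nz hol by (auto intro!: holomorphic_intros)
    show "continuous_on (closure (cball 0 1)) F"
      unfolding F_def u_def arc_weight_def
      using nz cont by (auto intro!: continuous_intros)
    show "z \<in> cball 0 1" using z by simp
    fix w :: complex assume "w \<in> frontier (cball 0 1)"
    then have w: "cmod w = 1" by simp
    have F: "cmod (F w) = cmod (G w) * exp (L * Re (u w))"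
      by (simp add: F_def norm_mult)
    show "cmod (F w) \<le> M"
    proof (cases "\<bar>Arg w\<bar> \<le> pi * s")
      case True
      have "L * Re (u w) \<le> L * 4"
        using L Re_arc_weight_le[OF s w] by (intro mult_left_mono) (auto simp: u_def)
      then have "exp (L * Re (u w)) \<le> exp (ln (1 / \<epsilon>))"
        unfolding exp_le_cancel_iff by (simp add: L_def)
      then have "exp (L * Re (u w)) \<le> 1 / \<epsilon>"
        using \<epsilon> by simp
      then have "cmod (F w) \<le> (M * \<epsilon>) * (1 / \<epsilon>)"
        unfolding F using small[OF w True] M0 \<epsilon> by (intro mult_mono) auto
      then show ?thesis using \<epsilon> by simp
    next
      case False
      have "L * Re (u w) \<le> 0"
        using L Re_arc_weight_off_arc[OF s w] False by (intro mult_nonneg_nonpos) (auto simp: u_def)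
      then have "exp (L * Re (u w)) \<le> 1" by simp
      then have "cmod (F w) \<le> M * 1"
        unfolding F using M[OF w] M0 by (intro mult_mono) auto
      then show ?thesis by simp
    qed
  qed simp
  have "L * (2 * s / 9) \<le> L * Re (u z)"
    using Re_arc_weight_ge[OF s z] L by (intro mult_left_mono) (auto simp: u_def)
  then have "cmod (G z) * exp (L * (2 * s / 9)) \<le> cmod (G z) * exp (L * Re (u z))"
    by (intro mult_left_mono) auto
  also have "\<dots> = cmod (F z)" by (simp add: F_def norm_mult)
  also have "\<dots> \<le> M" by fact
  finally have "cmod (G z) \<le> M * exp (- (L * (2 * s / 9)))"
    by (simp add: exp_minus field_simps)
  also have "- (L * (2 * s / 9)) = s / 18 * ln \<epsilon>"
    using \<epsilon> by (simp add: L_def ln_div)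
  finally show ?thesis using \<epsilon> by (simp add: powr_def)
qed

section \<open>Hoelder continuity up to the boundary\<close>

text \<open>The bound that \<open>2 * u * v \<le> u\<^sup>2 + v\<^sup>2\<close> gives for the sum of
  \<open>n powr (1/4) * cmod (a n)\<close>, with \<open>u = n * cmod (a n)\<close> and
  \<open>v = n powr (-3/4)\<close>; \<open>B\<close> bounds the sum of \<open>u\<^sup>2\<close>. An
  exponent below 1/2 keeps \<open>v\<^sup>2\<close> summable.\<close>

definition holder_const :: "real \<Rightarrow> real" where
  "holder_const B = (B + (\<Sum>n. real n powr (-3/2))) / 2"

lemma holder_const_nonneg: "B \<ge> 0 \<Longrightarrow> holder_const B \<ge> 0"
  unfolding holder_const_def
  by (intro divide_nonneg_nonneg add_nonneg_nonneg suminf_nonneg) (auto simp: summable_real_powr_iff)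

context
  fixes a :: "nat \<Rightarrow> complex" and B :: real
  assumes dirichlet: "\<And>N. (\<Sum>n<N. (real n * cmod (a n))\<^sup>2) \<le> B"
begin

lemma
  shows summable_quarter: "summable (\<lambda>n. real n powr (1/4) * cmod (a n))"
    and suminf_quarter_le: "(\<Sum>n. real n powr (1/4) * cmod (a n)) \<le> holder_const B"
proof -
  have s1: "summable (\<lambda>n. (real n * cmod (a n))\<^sup>2)"
    by (rule summableI_nonneg_bounded[OF _ dirichlet]) simp
  have s2: "summable (\<lambda>n. real n powr (-3/2))"
    by (simp add: summable_real_powr_iff)
  have s: "summable (\<lambda>n. ((real n * cmod (a n))\<^sup>2 + real n powr (-3/2)) / 2)"
    by (intro summable_divide summable_add s1 s2)
  \<comment> \<open>At \<open>n = 0\<close> both sides are 0, since \<open>powr\<close> with base 0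
    is 0 by convention; hence \<open>a 0\<close> is not controlled, and comparisons with this series
    start at index 1.\<close>
  have le: "real n powr (1/4) * cmod (a n) \<le> ((real n * cmod (a n))\<^sup>2 + real n powr (-3/2)) / 2" for n
  proof (cases "n = 0")
    case False
    define u v where "u = real n * cmod (a n)" and "v = real n powr (-3/4)"
    have "real n powr (1/4) = real n powr 1 * v"
      unfolding v_def powr_add[symmetric] by simp
    then have uv: "u * v = real n powr (1/4) * cmod (a n)"
      using False by (simp add: u_def)
    have "v\<^sup>2 = real n powr (-3/2)"
      unfolding v_def power2_eq_square powr_add[symmetric] by simp
    moreover have "2 * u * v \<le> u\<^sup>2 + v\<^sup>2" by (rule sum_squares_bound)
    ultimately show ?thesis by (simp add: uv mult.assoc flip: u_def)
  qed simp
  show summ: "summable (\<lambda>n. real n powr (1/4) * cmod (a n))"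
    by (rule summable_comparison_test'[OF s, of 0]) (use le in simp)
  have "(\<Sum>n. real n powr (1/4) * cmod (a n)) \<le> (\<Sum>n. ((real n * cmod (a n))\<^sup>2 + real n powr (-3/2)) / 2)"
    by (rule suminf_le[OF le summ s])
  also have "\<dots> = ((\<Sum>n. (real n * cmod (a n))\<^sup>2) + (\<Sum>n. real n powr (-3/2))) / 2"
    using suminf_divide[OF summable_add[OF s1 s2], of 2] suminf_add[OF s1 s2] by simp
  also have "\<dots> \<le> holder_const B"
    using suminf_le_const[OF s1 dirichlet] by (simp add: holder_const_def)
  finally show "(\<Sum>n. real n powr (1/4) * cmod (a n)) \<le> holder_const B" .
qed

lemma powser_summable_cball:
  assumes "cmod z \<le> 1"
  shows "summable (\<lambda>n. a n * z ^ n)"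
proof (rule summable_comparison_test'[OF summable_quarter, of 1])
  fix n :: nat assume "1 \<le> n"
  then have "1 \<le> real n powr (1/4)" by (intro ge_one_powr_ge_zero) auto
  then have "cmod (a n) \<le> real n powr (1/4) * cmod (a n)"
    by (simp add: mult_le_cancel_right1)
  moreover have "cmod (a n * z ^ n) \<le> cmod (a n)"
    using assms by (simp add: norm_mult norm_power mult_left_le power_le_one)
  ultimately show "norm (a n * z ^ n) \<le> real n powr (1/4) * cmod (a n)" by linarith
qed

text \<open>Termwise interpolation: with \<open>d = cmod (z - w)\<close>, the difference of the
  powers is at most both \<open>n * d\<close> and 2, hence at most
  \<open>2 * (n * d) powr (1/4)\<close>, whether \<open>n * d\<close> is below or above 1.\<close>

lemma powser_holder:
  assumes z: "cmod z \<le> 1" and w: "cmod w \<le> 1"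
  shows "cmod ((\<Sum>n. a n * z ^ n) - (\<Sum>n. a n * w ^ n)) \<le> 2 * holder_const B * cmod (z - w) powr (1/4)"
proof -
  define d where "d = cmod (z - w)"
  have pw: "cmod (z ^ n - w ^ n) \<le> 2 * (real n * d) powr (1/4)" for n
  proof (cases "real n * d \<le> 1")
    case True
    define t where "t = real n * d"
    have t: "0 \<le> t" "t \<le> 1" using True by (auto simp: t_def d_def)
    have "t \<le> t powr (1/4)"
    proof (cases "t = 0")
      case False
      then have "t powr 1 \<le> t powr (1/4)"
        using t by (intro powr_mono') auto
      then show ?thesis using t by simp
    qed simp
    moreover have "t powr (1/4) \<ge> 0" by simp
    moreover have "cmod (z ^ n - w ^ n) \<le> t"
      using norm_power_diff[OF z w, of n] by (simp add: t_def d_def)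
    ultimately show ?thesis unfolding t_def by linarith
  next
    case False
    then have "1 \<le> (real n * d) powr (1/4)" by (intro ge_one_powr_ge_zero) auto
    moreover have "cmod (z ^ n - w ^ n) \<le> 1 + 1"
      using z w by (intro order_trans[OF norm_triangle_ineq4] add_mono) (auto simp: norm_power power_le_one)
    ultimately show ?thesis by simp
  qed
  have s: "summable (\<lambda>n. real n powr (1/4) * cmod (a n) * (2 * d powr (1/4)))"
    by (intro summable_mult2 summable_quarter)
  have "(\<Sum>n. a n * z ^ n) - (\<Sum>n. a n * w ^ n) = (\<Sum>n. a n * (z ^ n - w ^ n))"
    using suminf_diff[OF powser_summable_cball[OF z] powser_summable_cball[OF w]]
    by (simp add: right_diff_distrib)
  also have "cmod \<dots> \<le> (\<Sum>n. real n powr (1/4) * cmod (a n) * (2 * d powr (1/4)))"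
  proof (rule norm_suminf_le[OF _ s])
    fix n
    have "cmod (a n * (z ^ n - w ^ n)) \<le> cmod (a n) * (2 * (real n * d) powr (1/4))"
      unfolding norm_mult by (intro mult_left_mono pw) auto
    then show "cmod (a n * (z ^ n - w ^ n)) \<le> real n powr (1/4) * cmod (a n) * (2 * d powr (1/4))"
      by (simp add: powr_mult d_def mult_ac)
  qed
  also have "\<dots> = (\<Sum>n. real n powr (1/4) * cmod (a n)) * (2 * d powr (1/4))"
    by (rule suminf_mult2[OF summable_quarter, symmetric])
  also have "\<dots> \<le> holder_const B * (2 * d powr (1/4))"
    by (intro mult_right_mono suminf_quarter_le) simp
  finally show ?thesis by (simp add: d_def mult_ac)
qed

lemma powser_continuous_cball: "continuous_on (cball 0 1) (\<lambda>z. \<Sum>n. a n * z ^ n)"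
  unfolding continuous_on_def
proof
  fix z :: complex assume z: "z \<in> cball 0 1"
  have "((\<lambda>w. (\<Sum>n. a n * w ^ n) - (\<Sum>n. a n * z ^ n)) \<longlongrightarrow> 0) (at z within cball 0 1)"
  proof (rule Lim_null_comparison)
    show "\<forall>\<^sub>F w in at z within cball 0 1. norm ((\<Sum>n. a n * w ^ n) - (\<Sum>n. a n * z ^ n))
        \<le> 2 * holder_const B * cmod (w - z) powr (1/4)"
      using z by (auto simp: eventually_at_filter intro!: always_eventually powser_holder)
    have "((\<lambda>w. cmod (w - z)) \<longlongrightarrow> cmod (z - z)) (at z within cball 0 1)"
      by (intro tendsto_intros)
    then have "((\<lambda>w. cmod (w - z) powr (1/4)) \<longlongrightarrow> 0) (at z within cball 0 1)"
      by (intro tendsto_zero_powrI[where b = "1/4"]) auto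
    then show "((\<lambda>w. 2 * holder_const B * cmod (w - z) powr (1/4)) \<longlongrightarrow> 0) (at z within cball 0 1)"
      by (rule tendsto_mult_right_zero)
  qed
  then show "((\<lambda>w. \<Sum>n. a n * w ^ n) \<longlongrightarrow> (\<Sum>n. a n * z ^ n)) (at z within cball 0 1)"
    by (simp add: Lim_null[symmetric])
qed

end

text \<open>The series is continuous up to the boundary and equals \<open>f\<close> inside, so the
  radial limit is its value.\<close>

lemma bval_eq_powser:
  assumes f: "f holomorphic_on ball 0 1"
    and dirichlet: "\<And>N. (\<Sum>n<N. (real n * cmod (coef f n))\<^sup>2) \<le> B"
    and x: "cmod x = 1"
  shows "bval f x = (\<Sum>n. coef f n * x ^ n)"
  unfolding bval_def
proof (rule tendsto_Lim)
  let ?G = "\<lambda>z. \<Sum>n. coef f n * z ^ n"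
  have "continuous_on {0..1::real} (\<lambda>r. ?G (of_real r * x))"
    by (rule continuous_on_compose2[OF powser_continuous_cball[OF dirichlet]])
      (auto intro!: continuous_intros simp: norm_mult x)
  then have "((\<lambda>r. ?G (of_real r * x)) \<longlongrightarrow> ?G (of_real 1 * x)) (at_left (1::real))"
    by (auto simp: continuous_on_def at_within_Icc_at_left dest!: bspec[of _ _ 1])
  moreover have "\<forall>\<^sub>F r in at_left (1::real). ?G (of_real r * x) = f (of_real r * x)"
    using eventually_at_left_real[of 0 1]
    by (rule eventually_mono) (auto simp: norm_mult x intro!: sums_unique[symmetric] coef_sums f)
  ultimately show "((\<lambda>r::real. f (of_real r * x)) \<longlongrightarrow> ?G x) (at_left 1)"
    by (simp add: filterlim_cong)
qed simp

lemma sum_weighted_coef2_le: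
  assumes "\<And>N. (\<Sum>n<N. (real (Suc n) * cmod (a (Suc n)))\<^sup>2) \<le> B"
  shows "(\<Sum>n<N. (real n * cmod (a n))\<^sup>2) \<le> B"
proof (cases N)
  case 0
  then show ?thesis using assms[of 0] by simp
next
  case (Suc m)
  then show ?thesis
    using assms[of m] by (simp add: sum.lessThan_Suc_shift del: sum.lessThan_Suc)
qed

section \<open>Fill distance and the final estimate\<close>

text \<open>A chord subtending the angle \<open>\<theta>\<close> has length
  \<open>2 * \<bar>sin (\<theta> / 2)\<bar>\<close>.\<close>

lemma norm_diff_le_angdist:
  assumes x: "cmod x = 1" and y: "cmod y = 1"
  shows "cmod (x - y) \<le> angdist x y"
proof -
  define \<theta> where "\<theta> = Arg (x * cnj y)"
  have n: "cmod (x * cnj y) = 1" using x y by (simp add: norm_mult)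
  then have c: "x * cnj y = cis \<theta>"
    by (simp only: \<theta>_def cis_Arg_unit)
  have "y * cnj y = 1" using y by (simp flip: complex_norm_square)
  then have "x - y = (x * cnj y - 1) * y" by (simp add: algebra_simps)
  then have "cmod (x - y) = cmod (exp (\<i> * of_real \<theta>) - 1)"
    using y by (simp add: norm_mult c cis_conv_exp)
  also have "\<dots> = 2 * \<bar>sin (\<theta> / 2)\<bar>" by (rule dist_exp_i_1)
  also have "\<dots> \<le> \<bar>\<theta>\<bar>" using abs_sin_x_le_abs_x[of "\<theta> / 2"] by simp
  finally show ?thesis by (simp add: angdist_def \<theta>_def)
qed

lemma norm_arc: "x \<in> arc a s \<Longrightarrow> cmod x = 1"
  by (auto simp: arc_def)

text \<open>The rotation factor is the midpoint of the arc; \<open>two_constants_arc\<close> treats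
  arcs centred at 1.\<close>

lemma rotate_into_arc:
  assumes "cmod w = 1" "\<bar>Arg w\<bar> \<le> pi * s"
  shows "w * cis (a + pi * s) \<in> arc a s"
proof -
  have "w = cis (Arg w)" using assms by (simp only: cis_Arg_unit)
  then have "w * cis (a + pi * s) = cis (Arg w + (a + pi * s))"
    by (metis cis_mult)
  moreover have "Arg w + (a + pi * s) \<in> {a .. a + 2 * pi * s}" using assms by auto
  ultimately show ?thesis unfolding arc_def by blast
qed

text \<open>A finite connected set has at most one point, but the start and the midpoint of the arc
  differ.\<close>

lemma infinite_arc:
  assumes "0 < s" "s < 1"
  shows "infinite (arc a s)"
proof
  assume fin: "finite (arc a s)"
  have "connected (arc a s)"
    unfolding arc_def by (intro connected_continuous_image continuous_intros) auto
  then obtain x where x: "arc a s \<subseteq> {x}"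
    using fin connected_finite_iff_sing by (metis empty_subsetI order_refl)
  have "cis a \<in> arc a s" "cis (a + pi * s) \<in> arc a s"
    unfolding arc_def using assms by auto
  then have "cis (a + pi * s) = cis a" using x by auto
  then have "cis (pi * s) = 1" by (simp flip: cis_mult)
  then have "cos (pi * s) = 1" by (metis cis.sel(1) one_complex.sel(1))
  moreover have "cos (pi * s) < cos 0"
    using assms by (intro cos_monotone_0_pi) auto
  ultimately show False by simp
qed

lemma Min_angdist_le_fill_dist:
  assumes "x \<in> I" "finite S" "S \<noteq> {}"
  shows "Min (angdist x ` S) \<le> fill_dist I S"
  unfolding fill_dist_def
proof (rule cSUP_upper[OF assms(1)])
  \<comment> \<open>A real supremum bounds its elements only if the set is bounded above; no angular
    distance exceeds \<open>pi\<close>.\<close>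
  have "Min (angdist x ` S) \<le> pi" for x
  proof -
    obtain y where "y \<in> S" using assms by auto
    then have "Min (angdist x ` S) \<le> angdist x y" using assms by simp
    also have "\<dots> \<le> pi" using Arg_bounded[of "x * cnj y"] by (auto simp: angdist_def abs_le_iff)
    finally show ?thesis .
  qed
  then show "bdd_above ((\<lambda>x. Min (angdist x ` S)) ` I)" by (intro bdd_aboveI2)
qed

lemma ex_near_in_fill_dist:
  assumes "x \<in> I" "finite S" "S \<noteq> {}"
  shows "\<exists>y\<in>S. angdist x y \<le> fill_dist I S"
proof -
  have "Min (angdist x ` S) \<in> angdist x ` S" using assms by (intro Min_in) auto
  then show ?thesis using Min_angdist_le_fill_dist[OF assms] by auto
qed

text \<open>The infinite arc has a point off the finite set \<open>S\<close>. Positivity gives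
  \<open>ln (1 / h)\<close> its meaning and makes \<open>h powr (1/4)\<close> a valid
  \<open>\<epsilon>\<close>.\<close>

lemma fill_dist_arc_pos:
  assumes s: "0 < s" "s < 1" and S: "finite S" "S \<noteq> {}" "S \<subseteq> arc a s"
  shows "0 < fill_dist (arc a s) S"
proof -
  obtain x where x: "x \<in> arc a s" "x \<notin> S"
    using infinite_arc[OF s] S(1) by (metis finite_subset subsetI)
  obtain y where y: "y \<in> S" "angdist x y \<le> fill_dist (arc a s) S"
    using ex_near_in_fill_dist[OF x(1) S(1,2)] by blast
  have "0 < cmod (x - y)" using x y by auto
  also have "\<dots> \<le> angdist x y"
    using x y S by (intro norm_diff_le_angdist) (auto intro: norm_arc)
  finally show ?thesis using y by linarith
qed

section \<open>Low-order and high-order Taylor coefficients\<close>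

lemma circ_mean2_le:
  assumes "\<And>t. cmod (f (of_real r * cis t)) \<le> B"
  shows "circ_mean2 f r \<le> B\<^sup>2"
proof (cases "(\<lambda>t. (cmod (f (of_real r * cis t)))\<^sup>2) integrable_on {0..2*pi}")
  case True
  have "integral {0..2*pi} (\<lambda>t. (cmod (f (of_real r * cis t)))\<^sup>2) \<le> integral {0..2*pi} (\<lambda>t. B\<^sup>2)"
    using True assms by (intro integral_le) (auto intro: power_mono)
  then show ?thesis by (simp add: circ_mean2_def field_simps)
next
  case False
  then show ?thesis by (simp add: circ_mean2_def not_integrable_integral)
qed

text \<open>Cauchy's estimate in l2 form: undoing the factor \<open>r ^ n\<close> in Parseval costs
  \<open>1 / r\<^sup>2\<close> per index.\<close>

lemma sum_coef2_le_of_bound: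
  assumes f: "f holomorphic_on ball 0 1" and r: "0 < r" "r < 1"
    and B: "\<And>z. cmod z \<le> r \<Longrightarrow> cmod (f z) \<le> B"
  shows "(\<Sum>n<N. (cmod (coef f n))\<^sup>2) \<le> (1 / r\<^sup>2) ^ N * B\<^sup>2"
proof -
  have s: "(\<lambda>n. (cmod (coef f n * complex_of_real r ^ n))\<^sup>2) sums circ_mean2 f r"
    using circ_mean2_sums[OF f, of r] r by simp
  have "(\<Sum>n<N. (cmod (coef f n))\<^sup>2) \<le> (\<Sum>n<N. (1 / r\<^sup>2) ^ N * (cmod (coef f n * complex_of_real r ^ n))\<^sup>2)"
  proof (rule sum_mono)
    fix n assume "n \<in> {..<N}"
    then have "(1 / r\<^sup>2) ^ n \<le> (1 / r\<^sup>2) ^ N"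
      using r by (intro power_increasing) (auto simp: power_le_one)
    then have "(1 / r\<^sup>2) ^ n * (cmod (coef f n * complex_of_real r ^ n))\<^sup>2
        \<le> (1 / r\<^sup>2) ^ N * (cmod (coef f n * complex_of_real r ^ n))\<^sup>2"
      by (rule mult_right_mono) simp
    moreover have "(1 / r\<^sup>2) ^ n * (cmod (coef f n * complex_of_real r ^ n))\<^sup>2 = (cmod (coef f n))\<^sup>2"
      using r by (simp add: norm_mult norm_power power_mult_distrib power_divide mult.commute flip: power_mult)
    ultimately show "(cmod (coef f n))\<^sup>2 \<le> (1 / r\<^sup>2) ^ N * (cmod (coef f n * complex_of_real r ^ n))\<^sup>2"
      by simp
  qed
  also have "\<dots> = (1 / r\<^sup>2) ^ N * (\<Sum>n<N. (cmod (coef f n * complex_of_real r ^ n))\<^sup>2)"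
    by (simp add: sum_distrib_left)
  also have "\<dots> \<le> (1 / r\<^sup>2) ^ N * circ_mean2 f r"
    using sum_le_suminf[OF sums_summable[OF s], of "{..<N}"] sums_unique[OF s]
    by (intro mult_left_mono) auto
  also have "\<dots> \<le> (1 / r\<^sup>2) ^ N * B\<^sup>2"
    using r by (intro mult_left_mono circ_mean2_le B) (auto simp: norm_mult)
  finally show ?thesis .
qed

text \<open>For \<open>n \<ge> N\<close> the derivative weight \<open>fact n / fact (n - k)\<close>
  is at least \<open>n choose k\<close>, hence at least \<open>(N / k) ^ k\<close>.\<close>

lemma sum_tail_le:
  fixes b :: "nat \<Rightarrow> real"
  assumes k: "1 \<le> k" "k \<le> N"
    and le: "\<And>m. (\<Sum>n<m. (fact (n + k) / fact n * b (n + k))\<^sup>2) \<le> B"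
  shows "(\<Sum>n=N..<m. (b n)\<^sup>2) \<le> (real k / real N) ^ (2 * k) * B"
proof -
  let ?w = "\<lambda>n. (fact n / fact (n - k) * b n)\<^sup>2"
  have "(b n)\<^sup>2 \<le> (real k / real N) ^ (2 * k) * ?w n" if n: "N \<le> n" for n
  proof -
    have kn: "k \<le> n" using k n by simp
    have "(real N / real k) ^ k \<le> (real n / real k) ^ k"
      using n by (intro power_mono divide_right_mono) auto
    also have "\<dots> \<le> real (n choose k)" by (rule binomial_ge_n_over_k_pow_k[OF kn])
    also have "\<dots> = fact n / (fact k * fact (n - k))" by (rule binomial_fact[OF kn])
    also have "\<dots> \<le> fact n / (1 * fact (n - k))"
      by (intro divide_left_mono mult_right_mono) (auto simp: fact_ge_1)
    finally have "(real N / real k) ^ k \<le> fact n / fact (n - k)" by simp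
    then have "((real N / real k) ^ k)\<^sup>2 \<le> (fact n / fact (n - k))\<^sup>2"
      by (intro power_mono) auto
    then have "(real k / real N) ^ (2 * k) * ((real N / real k) ^ k)\<^sup>2 * (b n)\<^sup>2
        \<le> (real k / real N) ^ (2 * k) * (fact n / fact (n - k))\<^sup>2 * (b n)\<^sup>2"
      by (intro mult_right_mono mult_left_mono) auto
    moreover have "(real k / real N) ^ (2 * k) * ((real N / real k) ^ k)\<^sup>2 = 1"
      using k by (simp add: power_divide mult.commute flip: power_mult)
    ultimately show ?thesis by (simp only: power_mult_distrib mult.assoc mult_1_left)
  qed
  then have "(\<Sum>n=N..<m. (b n)\<^sup>2) \<le> (\<Sum>n=N..<m. (real k / real N) ^ (2 * k) * ?w n)"
    by (intro sum_mono) auto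
  also have "\<dots> = (real k / real N) ^ (2 * k) * (\<Sum>n=N..<m. ?w n)"
    by (simp add: sum_distrib_left)
  \<comment> \<open>As \<open>k \<le> N\<close>, the range may be enlarged to start at
    \<open>k\<close>, matching the indices \<open>n + k\<close> of the hypothesis.\<close>
  also have "(\<Sum>n=N..<m. ?w n) \<le> (\<Sum>n=0+k..<m+k. ?w n)"
    using k by (intro sum_mono2) auto
  also have "\<dots> = (\<Sum>n<m. (fact (n + k) / fact n * b (n + k))\<^sup>2)"
    unfolding sum.shift_bounds_nat_ivl by (simp add: atLeast0LessThan)
  also have "\<dots> \<le> B" by (rule le)
  finally show ?thesis by (simp add: mult_left_mono)
qed

text \<open>A single term of the exponential series is at most its sum.\<close>

lemma exp_minus_le_fact_div_power:
  fixes y :: real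
  assumes "y > 0"
  shows "exp (- y) \<le> fact m / y ^ m"
proof -
  have "(\<Sum>n\<in>{m}. y ^ n /\<^sub>R fact n) \<le> (\<Sum>n. y ^ n /\<^sub>R fact n)"
    using assms by (intro sum_le_suminf summable_exp_generic) auto
  then have "y ^ m / fact m \<le> exp y" by (simp add: exp_def divide_inverse mult.commute)
  then show ?thesis using assms by (simp add: exp_minus field_simps)
qed

text \<open>The coefficients below index about \<open>L / 288\<close> are controlled by the smallness of \<open>f\<close>
  on the disk of radius 1/3, the others by the norm of the \<open>k\<close>-th derivative.\<close>
lemma H2_norm_le_of_small_on_disk:
  assumes k: "1 \<le> k" and f: "f holomorphic_on ball 0 1"
    and deriv: "\<And>N. (\<Sum>n<N. (fact (n + k) / fact n * cmod (coef f (n + k)))\<^sup>2) \<le> 4"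
    and L: "288 * real k \<le> L"
    and small: "\<And>z. cmod z \<le> 1/3 \<Longrightarrow> cmod (f z) \<le> M * exp (- L / 72)"
  shows "H2_norm f \<le> sqrt (exp 4 * M\<^sup>2 * fact (2 * k) * 72 ^ (2 * k) + 4 * (288 * real k) ^ (2 * k)) / L ^ k"
proof (rule H2_norm_le[OF f])
  define A where "A = exp 4 * M\<^sup>2 * fact (2 * k) * 72 ^ (2 * k) + 4 * (288 * real k) ^ (2 * k)"
  have A: "A \<ge> 0" by (simp add: A_def)
  have L0: "L > 0" using k L by simp
  show "0 \<le> sqrt A / L ^ k" using L0 A by simp
  \<comment> \<open>Recovering \<open>N\<close> coefficients from radius 1/3 costs
    \<open>9 ^ N \<le> exp (4 * N)\<close>. Since \<open>288 = 4 * 72\<close>, this uses up only one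
    of the two factors \<open>exp (- L / 72)\<close> in the squared bound, up to the constant
    \<open>exp 4\<close> from rounding.\<close>
  define N where "N = nat \<lceil>L / 288\<rceil>"
  have N: "L / 288 \<le> real N" "real N \<le> L / 288 + 1"
    using L0 unfolding N_def by linarith+
  have kN: "k \<le> N" using N L by linarith
  have "(1::real) + 1 \<le> exp 1" by (rule exp_ge_add_one_self)
  then have "(2::real) ^ 4 \<le> exp 1 ^ 4" by (intro power_mono) auto
  also have "\<dots> = exp (4::real)" by (simp flip: exp_of_nat_mult)
  finally have "(9::real) \<le> exp 4" by simp
  then have "(9::real) ^ N \<le> exp 4 ^ N" by (intro power_mono) auto
  also have "\<dots> = exp (4 * real N)" by (simp add: mult.commute flip: exp_of_nat_mult)
  also have "\<dots> \<le> exp (4 + L / 72)" using N by simp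
  finally have nine: "(9::real) ^ N \<le> exp (4 + L / 72)" .
  have head: "(\<Sum>n<N. (cmod (coef f n))\<^sup>2) \<le> exp 4 * M\<^sup>2 * fact (2 * k) * 72 ^ (2 * k) / L ^ (2 * k)"
  proof -
    have "(\<Sum>n<N. (cmod (coef f n))\<^sup>2) \<le> 9 ^ N * (M * exp (- L / 72))\<^sup>2"
      using sum_coef2_le_of_bound[OF f, of "1/3" "M * exp (- L / 72)" N] small
      by (simp add: power_divide)
    also have "\<dots> \<le> exp (4 + L / 72) * (M * exp (- L / 72))\<^sup>2"
      by (intro mult_right_mono nine) simp
    also have "\<dots> = M\<^sup>2 * (exp (4 + L / 72) * exp (- L / 72) * exp (- L / 72))"
      by (simp add: power2_eq_square)
    also have "exp (4 + L / 72) * exp (- L / 72) * exp (- L / 72) = exp 4 * exp (- (L / 72))"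
      by (simp flip: exp_add)
    \<comment> \<open>The surviving exponential is traded for the power \<open>L ^ (2 * k)\<close>
      that the tail also produces.\<close>
    also have "M\<^sup>2 * \<dots> \<le> M\<^sup>2 * (exp 4 * (fact (2 * k) / (L / 72) ^ (2 * k)))"
      using L0 by (intro mult_left_mono exp_minus_le_fact_div_power) auto
    also have "\<dots> = exp 4 * M\<^sup>2 * fact (2 * k) * 72 ^ (2 * k) / L ^ (2 * k)"
      by (simp add: power_divide mult_ac)
    finally show ?thesis .
  qed
  fix m
  have tail: "(\<Sum>n=N..<m. (cmod (coef f n))\<^sup>2) \<le> 4 * (288 * real k) ^ (2 * k) / L ^ (2 * k)"
  proof -
    have "(\<Sum>n=N..<m. (cmod (coef f n))\<^sup>2) \<le> (real k / real N) ^ (2 * k) * 4"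
      by (rule sum_tail_le[OF k kN deriv])
    also have "\<dots> \<le> (real k / (L / 288)) ^ (2 * k) * 4"
      using N L0 by (intro mult_right_mono power_mono divide_left_mono) auto
    also have "\<dots> = 4 * (288 * real k) ^ (2 * k) / L ^ (2 * k)"
      by (simp add: power_divide mult_ac)
    finally show ?thesis .
  qed
  have "(\<Sum>n<m. (cmod (coef f n))\<^sup>2) \<le> (\<Sum>n\<in>{..<N} \<union> {N..<m}. (cmod (coef f n))\<^sup>2)"
    by (intro sum_mono2) auto
  also have "\<dots> = (\<Sum>n<N. (cmod (coef f n))\<^sup>2) + (\<Sum>n=N..<m. (cmod (coef f n))\<^sup>2)"
    by (intro sum.union_disjoint) auto
  also have "\<dots> \<le> A / L ^ (2 * k)"
    using head tail by (simp add: A_def add_divide_distrib)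
  also have "\<dots> = (sqrt A / L ^ k)\<^sup>2"
    using A by (simp add: power_divide mult.commute flip: power_mult)
  finally show "(\<Sum>n<m. (cmod (coef f n))\<^sup>2) \<le> (sqrt A / L ^ k)\<^sup>2" .
qed

section \<open>Error bound for the minimal-norm interpolant\<close>

theorem theorem4:
  fixes k :: nat
  assumes "k \<ge> 1"
  shows "\<exists>\<alpha> \<gamma> :: real. \<alpha> > 0 \<and> \<gamma> > 0 \<and>
    (\<forall>(lam::real) (a::real) (f::complex \<Rightarrow> complex) (S::complex set) (fn::complex \<Rightarrow> complex).
       0 < lam \<and> lam < 1 \<and> Hk2 k f \<and> Hk2_norm k f \<le> 1 \<and>
       finite S \<and> S \<noteq> {} \<and> S \<subseteq> arc a lam \<and> min_interp k f S fn \<and>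
       fill_dist (arc a lam) S \<le> exp (- \<gamma> / lam)
       \<longrightarrow> H2_norm (\<lambda>z. f z - fn z) \<le> \<alpha> / (lam * ln (1 / fill_dist (arc a lam) S)) ^ k)"
proof -
  \<comment> \<open>The 4 is the square of the norm bound 2 for \<open>f - fn\<close>.\<close>
  define K where "K = holder_const 4"
  have K: "K \<ge> 0" by (simp add: K_def holder_const_nonneg)
  \<comment> \<open>Here 2 bounds the value at 0 and \<open>2 * K\<close> the change from 0 to any
    point of the closed disk.\<close>
  define M where "M = 2 + 2 * K"
  define \<alpha> where "\<alpha> = sqrt (exp 4 * M\<^sup>2 * fact (2 * k) * 72 ^ (2 * k) + 4 * (288 * real k) ^ (2 * k))"
  have "0 < (288 * real k) ^ (2 * k)" using assms by (intro zero_less_power) auto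
  then have "\<alpha> > 0" unfolding \<alpha>_def
    by (intro iffD2[OF real_sqrt_gt_0_iff] add_nonneg_pos mult_nonneg_nonneg) auto
  \<comment> \<open>The witness for \<open>\<gamma>\<close>: the hypothesis on the fill distance
    becomes \<open>L \<ge> 288 * k\<close>, so the cutoff index is at least
    \<open>k\<close>.\<close>
  moreover have "288 * real k > 0" using assms by simp
  moreover have "H2_norm (\<lambda>z. f z - fn z) \<le> \<alpha> / (lam * ln (1 / fill_dist (arc a lam) S)) ^ k"
    if lam: "0 < lam" "lam < 1" and f: "Hk2 k f" "Hk2_norm k f \<le> 1"
      and S: "finite S" "S \<noteq> {}" "S \<subseteq> arc a lam" and fn: "min_interp k f S fn"
      and h_le: "fill_dist (arc a lam) S \<le> exp (- (288 * real k) / lam)"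
    for lam a f S fn
  proof -
    define h where "h = fill_dist (arc a lam) S"
    have h0: "h > 0" unfolding h_def by (rule fill_dist_arc_pos[OF lam S])
    have h1: "h \<le> 1"
    proof -
      have "exp (- (288 * real k) / lam) \<le> 1" using lam by simp
      with h_le show ?thesis unfolding h_def by (rule order_trans)
    qed
    define L where "L = lam * ln (1 / h)"
    have "ln h \<le> - (288 * real k) / lam"
      using h_le h0 by (metis h_def ln_exp ln_le_cancel_iff exp_gt_zero)
    then have L: "288 * real k \<le> L"
      using lam h0 by (simp add: L_def ln_div field_simps)
    \<comment> \<open>\<open>f\<close> itself competes in the minimum problem.\<close>
    have fn_k: "Hk2 k fn" "Hk2_norm k fn \<le> 1"
      using fn f unfolding min_interp_def by (auto intro: order_trans)
    have hol: "f holomorphic_on ball 0 1" "fn holomorphic_on ball 0 1"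
      using f fn_k by (auto simp: Hk2_def H2_def)
    define g where "g = (\<lambda>z. f z - fn z)"
    have holg: "g holomorphic_on ball 0 1"
      unfolding g_def by (intro holomorphic_intros hol)
    have cg: "coef g n = coef f n - coef fn n" for n
      unfolding g_def by (rule coef_diff[OF hol])
    have sumg: "(\<Sum>n<N. (fact (n + j) / fact n * cmod (coef g (n + j)))\<^sup>2) \<le> 4" if "j \<le> k" for j N
    proof -
      let ?w = "\<lambda>n. fact (n + j) / fact n :: real"
      have "(?w n * cmod (coef g (n + j)))\<^sup>2
          \<le> 2 * (?w n * cmod (coef f (n + j)))\<^sup>2 + 2 * (?w n * cmod (coef fn (n + j)))\<^sup>2" for n
      proof -
        have "?w n * cmod (coef g (n + j)) \<le> ?w n * (cmod (coef f (n + j)) + cmod (coef fn (n + j)))"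
          unfolding cg by (intro mult_left_mono norm_triangle_ineq4) auto
        then have "(?w n * cmod (coef g (n + j)))\<^sup>2
            \<le> (?w n * cmod (coef f (n + j)) + ?w n * cmod (coef fn (n + j)))\<^sup>2"
          by (intro power_mono) (auto simp: distrib_left)
        also have "\<dots> \<le> 2 * (?w n * cmod (coef f (n + j)))\<^sup>2 + 2 * (?w n * cmod (coef fn (n + j)))\<^sup>2"
          using sum_squares_bound[of "?w n * cmod (coef f (n + j))" "?w n * cmod (coef fn (n + j))"]
          unfolding power2_sum by linarith
        finally show ?thesis .
      qed
      then have "(\<Sum>n<N. (?w n * cmod (coef g (n + j)))\<^sup>2)
          \<le> (\<Sum>n<N. 2 * (?w n * cmod (coef f (n + j)))\<^sup>2 + 2 * (?w n * cmod (coef fn (n + j)))\<^sup>2)"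
        by (rule sum_mono)
      also have "\<dots> = 2 * (\<Sum>n<N. (?w n * cmod (coef f (n + j)))\<^sup>2)
          + 2 * (\<Sum>n<N. (?w n * cmod (coef fn (n + j)))\<^sup>2)"
        by (simp only: sum.distrib sum_distrib_left)
      also have "\<dots> \<le> 4"
        using sum_coef2_deriv_le[OF f that, of N] sum_coef2_deriv_le[OF fn_k that, of N] by linarith
      finally show ?thesis .
    qed
    \<comment> \<open>The case \<open>j = 1\<close>, where the quotient of factorials is
      \<open>n + 1\<close>; the restored term of index 0 has weight 0.\<close>
    have dir: "(\<Sum>n<N. (real n * cmod (coef f n))\<^sup>2) \<le> 1" "(\<Sum>n<N. (real n * cmod (coef fn n))\<^sup>2) \<le> 1"
      "(\<Sum>n<N. (real n * cmod (coef g n))\<^sup>2) \<le> 4" for N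
      using sum_coef2_deriv_le[OF f assms] sum_coef2_deriv_le[OF fn_k assms] sumg[OF assms]
      by (auto intro!: sum_weighted_coef2_le simp: fact_reduce)
    \<comment> \<open>The continuous extension of \<open>g\<close> to the closed disk; the values of
      \<open>g\<close> itself on the circle are arbitrary.\<close>
    define G where "G = (\<lambda>z. \<Sum>n. coef g n * z ^ n)"
    have Gg: "G z = g z" if "cmod z < 1" for z
      unfolding G_def using coef_sums[OF holg that] by (rule sums_unique[symmetric])
    have contG: "continuous_on (cball 0 1) G"
      unfolding G_def by (rule powser_continuous_cball[OF dir(3)])
    have holder: "cmod (G z - G w) \<le> 2 * K * cmod (z - w) powr (1/4)" if "cmod z \<le> 1" "cmod w \<le> 1" for z w
      unfolding G_def K_def by (rule powser_holder[OF dir(3) that])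
    have GM: "cmod (G z) \<le> M" if z: "cmod z \<le> 1" for z
    proof -
      have "(cmod (coef g 0))\<^sup>2 \<le> 2\<^sup>2" using sumg[of 0 1] by simp
      then have "cmod (G 0) \<le> 2"
        unfolding G_def powser_zero by (rule power2_le_imp_le) simp
      moreover have "2 * K * cmod z powr (1/4) \<le> 2 * K * 1"
        using K z by (intro mult_left_mono powr_le1) auto
      moreover have "cmod (G z - G 0) \<le> 2 * K * cmod z powr (1/4)" using holder[of z 0] z by simp
      ultimately show ?thesis
        using norm_triangle_sub[of "G z" "G 0"] by (simp add: M_def)
    qed
    have GS: "G y = 0" if "y \<in> S" for y
    proof -
      have y: "cmod y = 1" using that S norm_arc by blast
      have "G y = (\<Sum>n. coef f n * y ^ n - coef fn n * y ^ n)"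
        by (simp add: G_def cg left_diff_distrib)
      also have "\<dots> = (\<Sum>n. coef f n * y ^ n) - (\<Sum>n. coef fn n * y ^ n)"
        using y by (intro suminf_diff[symmetric] powser_summable_cball[OF dir(1)] powser_summable_cball[OF dir(2)]) auto
      also have "\<dots> = bval f y - bval fn y"
        by (simp add: bval_eq_powser[OF hol(1) dir(1) y] bval_eq_powser[OF hol(2) dir(2) y])
      also have "\<dots> = 0" using fn that by (simp add: min_interp_def)
      finally show ?thesis .
    qed
    have Garc: "cmod (G x) \<le> M * h powr (1/4)" if x: "x \<in> arc a lam" for x
    proof -
      obtain y where y: "y \<in> S" "angdist x y \<le> h"
        using ex_near_in_fill_dist[OF x S(1,2)] by (auto simp: h_def)
      have xy: "cmod x = 1" "cmod y = 1" using x y S norm_arc by blast+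
      have "cmod (G x) \<le> 2 * K * cmod (x - y) powr (1/4)"
        using holder[of x y] xy GS[OF y(1)] by simp
      also have "\<dots> \<le> M * h powr (1/4)"
        using norm_diff_le_angdist[OF xy] y K by (intro mult_mono powr_mono2) (auto simp: M_def)
      finally show ?thesis .
    qed
    \<comment> \<open>The midpoint of the arc; \<open>w * c\<close> carries the arc centred at 1
      onto the given one.\<close>
    define c where "c = cis (a + pi * lam)"
    have c: "cmod c = 1" by (simp add: c_def)
    have disk: "cmod (g z) \<le> M * exp (- L / 72)" if z: "cmod z \<le> 1/3" for z
    proof -
      have "cmod (G ((z / c) * c)) \<le> M * (h powr (1/4)) powr (lam / 18)"
      proof (rule two_constants_arc[where G = "\<lambda>w. G (w * c)"])
        show "continuous_on (cball 0 1) (\<lambda>w. G (w * c))"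
          by (rule continuous_on_compose2[OF contG]) (auto intro!: continuous_intros simp: norm_mult c)
        have "(g \<circ> (\<lambda>w. w * c)) holomorphic_on ball 0 1"
          by (rule holomorphic_on_compose_gen[OF _ holg]) (auto intro!: holomorphic_intros simp: norm_mult c)
        then show "(\<lambda>w. G (w * c)) holomorphic_on ball 0 1"
          by (rule holomorphic_transform) (simp add: Gg norm_mult c)
        show "0 < h powr (1/4)" "h powr (1/4) \<le> 1" using h0 h1 by (auto intro: powr_le1)
        show "cmod (G (w * c)) \<le> M" if "cmod w = 1" for w
          using that by (intro GM) (simp add: norm_mult c)
        show "cmod (G (w * c)) \<le> M * h powr (1/4)" if "cmod w = 1" "\<bar>Arg w\<bar> \<le> pi * lam" for w
          using rotate_into_arc[OF that] by (intro Garc) (simp add: c_def)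
        show "cmod (z / c) \<le> 1/3" using z c by (simp add: norm_divide)
      qed (use lam in auto)
      moreover have "c \<noteq> 0" using c by auto
      \<comment> \<open>The Hoelder exponent times the two-constants exponent,
        \<open>1/4 * 1/18\<close>, is the source of 72.\<close>
      moreover have "(h powr (1/4)) powr (lam / 18) = exp (- L / 72)"
        using h0 by (simp add: powr_powr powr_def L_def ln_div)
      ultimately show ?thesis using z by (simp add: Gg)
    qed
    have "H2_norm g \<le> \<alpha> / L ^ k"
      unfolding \<alpha>_def by (rule H2_norm_le_of_small_on_disk[OF assms holg sumg[OF order_refl] L disk])
    then show ?thesis by (simp add: g_def L_def h_def)
  qed
  ultimately show ?thesis by blast
qed

end
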